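(* Let $q\ge1$ be an integer, $\beta,J$ constants with $\mathrm{e}^{\beta J}\neq1$, and $\boldsymbol{B}=(B_1,\dots,B_q)\in\mathbb{C}^q$. Let $G$ be a finite graph where each vertex $v_i$ carries the magnetic field vector $\boldsymbol{M}_i=k_i\boldsymbol{B}$ with $k_i\in\mathbb{Z}^+$, and let $Z(G)=\sum_\sigma\mathrm{e}^{-\beta h(\sigma)}$ with \[h(\sigma)=-J\sum_{\{v_i,v_j\}\in E(G)}\delta(\sigma_i,\sigma_j)-\sum_{v_i\in V(G)}\sum_{\alpha=1}^q k_iB_\alpha\,\delta(\alpha,\sigma_i).\] Then \[Z(G)=(\mathrm{e}^{\beta J}-1)^{|V(G)|}\,W\big(G,\omega;\{x_k\}_{k\in\mathbb{Z}^+},\mathrm{e}^{\beta J}\big),\qquad x_k=\frac{1}{\mathrm{e}^{\beta J}-1}\sum_{\alpha=1}^q\mathrm{e}^{\beta kB_\alpha},\] where the vertex weights are $\omega(v_i)=k_i$.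
   Context: Graphs are finite, loops and multiple edges allowed (the sum over edges counts each edge). A state is a map $\sigma:V(G)\to\{1,\dots,q\}$, $\sigma_i=\sigma(v_i)$; $Z$ sums over all states; $\delta$ is the Kronecker delta. Noble and Welsh's $W$-polynomial $W(G,\omega;\boldsymbol{x},y)$ of a graph with vertex weights $\omega:V(G)\to\mathbb{Z}^+$ and variables $\boldsymbol{x}=\{x_k\}_{k\in\mathbb{Z}^+},y$ is defined recursively by: for a non-loop edge $e$, $W(G)=W(G-e)+W(G/e)$; for a loop $e$, $W(G)=yW(G-e)$; for $m$ isolated vertices of weights $\omega_1,\dots,\omega_m$, $W=\prod_{i=1}^m x_{\omega_i}$. Here $G-e$ deletes $e$, weights unchanged, and $G/e$ contracts a non-loop edge $e=\{v_a,v_b\}$, the merged vertex receiving weight $\omega(v_a)+\omega(v_b)$. *)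

theory Defs
  imports Complex_Main "HOL-Library.FuncSet" "HOL-Library.Uprod"
begin

section \<open>Multigraphs\<close>

text \<open>Edges are abstract objects, each with an unordered pair of end vertices, so parallel edges
  are distinct edges with the same ends and \<open>Upair v v\<close> is the pair of ends of a loop.\<close>

record ('v, 'e) multigraph =
  verts :: "'v set"
  edges :: "'e set"
  ends :: "'e \<Rightarrow> 'v uprod"

definition finite_multigraph :: "('v, 'e) multigraph \<Rightarrow> bool" where
  "finite_multigraph G \<longleftrightarrow> finite (verts G) \<and> finite (edges G) \<and>
     (\<forall>e\<in>edges G. set_uprod (ends G e) \<subseteq> verts G)"

definition delete_edge :: "('v, 'e) multigraph \<Rightarrow> 'e \<Rightarrow> ('v, 'e) multigraph" where
  "delete_edge G e = G\<lparr>edges := edges G - {e}\<rparr>"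

text \<open>Contraction of a non-loop edge \<open>e\<close> with ends \<open>a\<close> and \<open>b\<close>: the merged vertex is named \<open>a\<close>.
  Other edges between \<open>a\<close> and \<open>b\<close> become loops at \<open>a\<close>.\<close>

definition contract_edge :: "('v, 'e) multigraph \<Rightarrow> 'e \<Rightarrow> 'v \<Rightarrow> 'v \<Rightarrow> ('v, 'e) multigraph" where
  "contract_edge G e a b =
     \<lparr>verts = verts G - {b}, edges = edges G - {e},
      ends = (\<lambda>f. map_uprod (\<lambda>u. if u = b then a else u) (ends G f))\<rparr>"

definition contract_weight :: "('v \<Rightarrow> nat) \<Rightarrow> 'v \<Rightarrow> 'v \<Rightarrow> 'v \<Rightarrow> nat" where
  "contract_weight \<omega> a b = \<omega>(a := \<omega> a + \<omega> b)"


section \<open>The W-polynomial of Noble and Welsh\<close>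

text \<open>\<open>W_rel x y G \<omega> w\<close> says that \<open>w\<close> is obtained from \<open>G\<close> by some sequence of applications of
  the recursion, with the edges taken in any order and the merged vertex of a contraction
  named after either end. The variables take values in an arbitrary commutative ring,
  the choice of a polynomial ring and its indeterminates giving the polynomial itself.\<close>

inductive W_rel ::
    "(nat \<Rightarrow> 'a::comm_ring_1) \<Rightarrow> 'a \<Rightarrow> ('v, 'e) multigraph \<Rightarrow> ('v \<Rightarrow> nat) \<Rightarrow> 'a \<Rightarrow> bool"
  for x :: "nat \<Rightarrow> 'a" and y :: 'a where
  isolated: "edges G = {} \<Longrightarrow> W_rel x y G \<omega> (\<Prod>v\<in>verts G. x (\<omega> v))"
| non_loop: "\<lbrakk>e \<in> edges G; ends G e = Upair a b; a \<noteq> b;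
     W_rel x y (delete_edge G e) \<omega> w1;
     W_rel x y (contract_edge G e a b) (contract_weight \<omega> a b) w2\<rbrakk>
   \<Longrightarrow> W_rel x y G \<omega> (w1 + w2)"
| loop: "\<lbrakk>e \<in> edges G; ends G e = Upair a a; W_rel x y (delete_edge G e) \<omega> w\<rbrakk>
   \<Longrightarrow> W_rel x y G \<omega> (y * w)"

text \<open>Noble and Welsh proved that the outcome of the recursion does not depend on these choices.\<close>

definition W_polynomial ::
    "('v, 'e) multigraph \<Rightarrow> ('v \<Rightarrow> nat) \<Rightarrow> (nat \<Rightarrow> 'a::comm_ring_1) \<Rightarrow> 'a \<Rightarrow> 'a" where
  "W_polynomial G \<omega> x y = (THE w. W_rel x y G \<omega> w)"


section \<open>The Potts model with a vertex-dependent magnetic field\<close>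

definition kronecker :: "'s \<Rightarrow> 's \<Rightarrow> complex" where
  "kronecker s t = (if s = t then 1 else 0)"

lift_definition kronecker_ends :: "('v \<Rightarrow> 's) \<Rightarrow> 'v uprod \<Rightarrow> complex"
  is "\<lambda>\<sigma> (u, v). kronecker (\<sigma> u) (\<sigma> v)"
  by (auto simp: kronecker_def)

lemma kronecker_ends_Upair [simp]:
  "kronecker_ends \<sigma> (Upair u v) = kronecker (\<sigma> u) (\<sigma> v)"
  by transfer simp

definition states :: "('v, 'e) multigraph \<Rightarrow> nat \<Rightarrow> ('v \<Rightarrow> nat) set" where
  "states G q = verts G \<rightarrow>\<^sub>E {1..q}"

text \<open>\<open>M v \<alpha>\<close> is the \<open>\<alpha>\<close>-th coordinate of the field vector at the vertex \<open>v\<close>, for \<open>1 \<le> \<alpha> \<le> q\<close>.\<close>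

definition hamiltonian ::
    "('v, 'e) multigraph \<Rightarrow> nat \<Rightarrow> complex \<Rightarrow> ('v \<Rightarrow> nat \<Rightarrow> complex) \<Rightarrow> ('v \<Rightarrow> nat) \<Rightarrow> complex" where
  "hamiltonian G q J M \<sigma> =
     - J * (\<Sum>e\<in>edges G. kronecker_ends \<sigma> (ends G e))
     - (\<Sum>v\<in>verts G. \<Sum>\<alpha>=1..q. M v \<alpha> * kronecker \<alpha> (\<sigma> v))"

definition partition_function ::
    "('v, 'e) multigraph \<Rightarrow> nat \<Rightarrow> complex \<Rightarrow> complex \<Rightarrow> ('v \<Rightarrow> nat \<Rightarrow> complex) \<Rightarrow> complex" where
  "partition_function G q \<beta> J M = (\<Sum>\<sigma>\<in>states G q. exp (- \<beta> * hamiltonian G q J M \<sigma>))"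

end

theory Submission
  imports Defs
begin

text \<open>Since \<open>exp (\<beta> J \<delta>) = 1 + (exp (\<beta> J) - 1) \<delta>\<close>, expanding the factor of one non-loop edge
  splits the partition function into that of \<open>G - e\<close> plus \<open>exp (\<beta> J) - 1\<close> times that of \<open>G / e\<close>,
  the fields of the merged vertices adding up. Hence every value that the recursion can produce
  at these variables, multiplied by \<open>(exp (\<beta> J) - 1) ^ card (verts G)\<close>, equals the partition
  function. As \<open>exp (\<beta> J) \<noteq> 1\<close>, this also shows that the recursion has only one outcome here,
  so the description in the definition of \<open>W_polynomial\<close> is proper without appeal to the
  theorem of Noble and Welsh.\<close>

lemma verts_delete_edge [simp]: "verts (delete_edge G e) = verts G"
  by (simp add: delete_edge_def)

lemma verts_contract_edge [simp]: "verts (contract_edge G e a b) = verts G - {b}"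
  by (simp add: contract_edge_def)

lemma finite_multigraph_delete_edge:
  "finite_multigraph G \<Longrightarrow> finite_multigraph (delete_edge G e)"
  by (auto simp: finite_multigraph_def delete_edge_def)

lemma finite_multigraph_contract_edge:
  assumes "finite_multigraph G" "a \<in> verts G" "a \<noteq> b"
  shows "finite_multigraph (contract_edge G e a b)"
  using assms unfolding finite_multigraph_def contract_edge_def
  by (fastforce simp: uprod.set_map)

text \<open>Deletion and contraction both remove exactly one edge, so the recursion terminates
  whichever edge is taken first. This gives the existence half of the description in
  \<open>W_polynomial\<close>.\<close>

lemma W_rel_exists:
  assumes "finite (edges G)"
  shows "\<exists>w. W_rel x y G \<omega> w"
  using assms
proof (induction "card (edges G)" arbitrary: G \<omega>)
  case 0
  then show ?case by (auto intro: W_rel.isolated)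
next
  case (Suc n)
  then obtain e where e: "e \<in> edges G"
    by fastforce
  obtain a b where ab: "ends G e = Upair a b"
    by (metis uprod_exhaust)
  have del: "\<exists>w. W_rel x y (delete_edge G e) \<omega> w"
    using Suc e by (intro Suc.hyps(1)) (auto simp: delete_edge_def)
  have con: "\<exists>w. W_rel x y (contract_edge G e a b) (contract_weight \<omega> a b) w"
    using Suc e by (intro Suc.hyps(1)) (auto simp: contract_edge_def)
  show ?case
  proof (cases "a = b")
    case True
    then show ?thesis using W_rel.loop[OF e] ab del by metis
  next
    case False
    then show ?thesis using W_rel.non_loop[OF e ab] del con by metis
  qed
qed

lemma kronecker_ends_map_uprod:
  "kronecker_ends \<sigma> (map_uprod h p) = kronecker_ends (\<sigma> \<circ> h) p"
  by (cases p) simp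

lemma kronecker_ends_cases: "kronecker_ends \<sigma> p \<in> {0, 1}"
  by (cases p) (simp add: kronecker_def)

text \<open>The summand of the partition function in product form, with \<open>y\<close> in the role
  of exp (\<beta> J) and \<open>g n s\<close> in that of exp (\<beta> n B_s). An edge contributes
  \<open>y\<close> if its ends agree and 1 otherwise.\<close>

definition boltzmann_weight ::
    "(nat \<Rightarrow> 's \<Rightarrow> complex) \<Rightarrow> complex \<Rightarrow> ('v, 'e) multigraph \<Rightarrow> ('v \<Rightarrow> nat) \<Rightarrow> ('v \<Rightarrow> 's) \<Rightarrow> complex"
  where "boltzmann_weight g y G \<omega> \<sigma> =
    (\<Prod>e\<in>edges G. 1 + (y - 1) * kronecker_ends \<sigma> (ends G e)) * (\<Prod>v\<in>verts G. g (\<omega> v) (\<sigma> v))"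

lemma boltzmann_weight_delete_edge:
  assumes "finite (edges G)" "e \<in> edges G"
  shows "boltzmann_weight g y G \<omega> \<sigma> =
    (1 + (y - 1) * kronecker_ends \<sigma> (ends G e)) * boltzmann_weight g y (delete_edge G e) \<omega> \<sigma>"
  using assms by (simp add: boltzmann_weight_def delete_edge_def prod.remove mult.assoc)

text \<open>Edge factors match because renaming \<open>b\<close> to \<open>a\<close> in the ends
  amounts to precomposing the state with that renaming. Vertex factors match because
  \<open>g\<close> turns the added weights of the merged vertex into a product.\<close>

lemma boltzmann_weight_contract_edge:
  assumes fin: "finite (verts G)" and a: "a \<in> verts G" and b: "b \<in> verts G" and "a \<noteq> b"
    and g: "\<And>m n s. g (m + n) s = g m s * g n s"
  shows "boltzmann_weight g y (contract_edge G e a b) (contract_weight \<omega> a b) \<tau> =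
    boltzmann_weight g y (delete_edge G e) \<omega> (\<tau>(b := \<tau> a))"
proof -
  have comp: "\<tau> \<circ> (\<lambda>u. if u = b then a else u) = \<tau>(b := \<tau> a)"
    by auto
  have 1: "(\<Prod>v\<in>verts G - {b}. g (contract_weight \<omega> a b v) (\<tau> v)) =
      g (\<omega> a + \<omega> b) (\<tau> a) * (\<Prod>v\<in>verts G - {b} - {a}. g (\<omega> v) (\<tau> v))"
    using assms by (subst prod.remove[of _ a]) (auto simp: contract_weight_def)
  have 2: "(\<Prod>v\<in>verts G. g (\<omega> v) ((\<tau>(b := \<tau> a)) v)) =
      g (\<omega> b) (\<tau> a) * (g (\<omega> a) (\<tau> a) * (\<Prod>v\<in>verts G - {b} - {a}. g (\<omega> v) (\<tau> v)))"
    using assms by (subst prod.remove[of _ b], simp, simp, subst prod.remove[of _ a]) auto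
  show ?thesis
    using 1 2 g
    by (simp add: boltzmann_weight_def contract_edge_def delete_edge_def
        kronecker_ends_map_uprod comp mult_ac del: fun_upd_apply)
qed

text \<open>A state that agrees on \<open>a\<close> and \<open>b\<close> is determined by its
  restriction to \<open>V - {b}\<close>.\<close>

lemma bij_betw_PiE_identify:
  assumes "a \<in> V" "b \<in> V" "a \<noteq> b"
  shows "bij_betw (\<lambda>\<tau>. \<tau>(b := \<tau> a)) ((V - {b}) \<rightarrow>\<^sub>E S) {\<sigma> \<in> V \<rightarrow>\<^sub>E S. \<sigma> a = \<sigma> b}"
\<comment> \<open>Members of \<open>(V - {b}) \<rightarrow>\<^sub>E S\<close> take the value
  \<open>undefined\<close> at \<open>b\<close>, so the inverse forgets a coordinate by resetting it
  to \<open>undefined\<close>.\<close>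
proof (rule bij_betwI[where g = "\<lambda>\<sigma>. \<sigma>(b := undefined)"])
  show "(\<lambda>\<tau>. \<tau>(b := \<tau> a)) \<in> ((V - {b}) \<rightarrow>\<^sub>E S) \<rightarrow> {\<sigma> \<in> V \<rightarrow>\<^sub>E S. \<sigma> a = \<sigma> b}"
  proof (rule Pi_I)
    fix \<tau> assume \<tau>: "\<tau> \<in> (V - {b}) \<rightarrow>\<^sub>E S"
    then have "\<tau> a \<in> S"
      using assms by (intro PiE_mem[OF \<tau>]) simp
    then have "\<tau>(b := \<tau> a) \<in> insert b (V - {b}) \<rightarrow>\<^sub>E S"
      by (rule PiE_fun_upd) (rule \<tau>)
    then show "\<tau>(b := \<tau> a) \<in> {\<sigma> \<in> V \<rightarrow>\<^sub>E S. \<sigma> a = \<sigma> b}"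
      using assms by (simp add: insert_absorb)
  qed
  show "(\<lambda>\<sigma>. \<sigma>(b := undefined)) \<in> {\<sigma> \<in> V \<rightarrow>\<^sub>E S. \<sigma> a = \<sigma> b} \<rightarrow> ((V - {b}) \<rightarrow>\<^sub>E S)"
    by (auto simp: PiE_iff extensional_def)
next
  fix \<tau> assume "\<tau> \<in> (V - {b}) \<rightarrow>\<^sub>E S"
  then show "(\<tau>(b := \<tau> a))(b := undefined) = \<tau>"
    by (metis PiE_arb DiffD2 singletonI fun_upd_triv fun_upd_upd)
next
  fix \<sigma> assume "\<sigma> \<in> {\<sigma> \<in> V \<rightarrow>\<^sub>E S. \<sigma> a = \<sigma> b}"
  then have "\<sigma> a = \<sigma> b"
    by simp
  then show "(\<sigma>(b := undefined))(b := (\<sigma>(b := undefined)) a) = \<sigma>"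
    using \<open>a \<noteq> b\<close> by (simp add: fun_upd_idem_iff)
qed

text \<open>The delta cuts the sum down to the states that agree on \<open>a\<close> and
  \<open>b\<close>, and these correspond to the states of the contracted graph.\<close>

lemma sum_kronecker_boltzmann_weight:
  assumes "finite (verts G)" "finite S" "a \<in> verts G" "b \<in> verts G" "a \<noteq> b"
    and "\<And>m n s. g (m + n) s = g m s * g n s"
  shows "(\<Sum>\<sigma>\<in>verts G \<rightarrow>\<^sub>E S. kronecker (\<sigma> a) (\<sigma> b) * boltzmann_weight g y (delete_edge G e) \<omega> \<sigma>) =
    (\<Sum>\<tau>\<in>(verts G - {b}) \<rightarrow>\<^sub>E S.
      boltzmann_weight g y (contract_edge G e a b) (contract_weight \<omega> a b) \<tau>)"
proof -
  have "(\<Sum>\<sigma>\<in>verts G \<rightarrow>\<^sub>E S. kronecker (\<sigma> a) (\<sigma> b) * boltzmann_weight g y (delete_edge G e) \<omega> \<sigma>) =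
      (\<Sum>\<sigma>\<in>{\<sigma> \<in> verts G \<rightarrow>\<^sub>E S. \<sigma> a = \<sigma> b}. boltzmann_weight g y (delete_edge G e) \<omega> \<sigma>)"
    using assms
    by (intro sum.mono_neutral_cong_right) (auto intro: finite_PiE simp: kronecker_def)
  also have "\<dots> = (\<Sum>\<tau>\<in>(verts G - {b}) \<rightarrow>\<^sub>E S.
      boltzmann_weight g y (delete_edge G e) \<omega> (\<tau>(b := \<tau> a)))"
    by (rule sum.reindex_bij_betw[OF bij_betw_PiE_identify, symmetric]) (use assms in auto)
  finally show ?thesis
    using assms by (simp add: boltzmann_weight_contract_edge)
qed

text \<open>Induction on the derivation of \<open>w\<close> covers every order of the edges at once.
  The power of \<open>y - 1\<close> arises from the isolated vertices, each of which contributes (y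
  - 1) x_n.\<close>

lemma W_rel_sum_boltzmann_weight:
  assumes "W_rel x y G \<omega> w" "finite_multigraph G" "finite S"
    and x: "\<And>n. (y - 1) * x n = (\<Sum>s\<in>S. g n s)"
    and g: "\<And>m n s. g (m + n) s = g m s * g n s"
  shows "(\<Sum>\<sigma>\<in>verts G \<rightarrow>\<^sub>E S. boltzmann_weight g y G \<omega> \<sigma>) = (y - 1) ^ card (verts G) * w"
  using assms(1,2)
proof (induction rule: W_rel.induct)
  case (isolated G \<omega>)
  then have "finite (verts G)"
    by (simp add: finite_multigraph_def)
  \<comment> \<open>Without edges the sum over states factors vertex by vertex.\<close>
  then have "(\<Sum>\<sigma>\<in>verts G \<rightarrow>\<^sub>E S. boltzmann_weight g y G \<omega> \<sigma>) = (\<Prod>v\<in>verts G. \<Sum>s\<in>S. g (\<omega> v) s)"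
    using isolated \<open>finite S\<close> by (simp add: boltzmann_weight_def prod_sum_PiE)
  then show ?case
    by (simp add: x[symmetric] prod.distrib)
next
  case (non_loop e G a b \<omega> w1 w2)
  have fin: "finite (verts G)" "finite (edges G)" and ab: "a \<in> verts G" "b \<in> verts G"
    using non_loop by (fastforce simp: finite_multigraph_def)+
  \<comment> \<open>Contraction loses one vertex; the factor \<open>y - 1\<close> in front of the
    delta makes up for the missing power.\<close>
  have card: "card (verts G) = Suc (card (verts G - {b}))"
    using fin ab by (metis card_Suc_Diff1)
  have del: "(\<Sum>\<sigma>\<in>verts G \<rightarrow>\<^sub>E S. boltzmann_weight g y (delete_edge G e) \<omega> \<sigma>) =
      (y - 1) ^ card (verts G) * w1"
    using non_loop.IH(1) non_loop.prems by (simp add: finite_multigraph_delete_edge)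
  have con: "(\<Sum>\<tau>\<in>(verts G - {b}) \<rightarrow>\<^sub>E S.
      boltzmann_weight g y (contract_edge G e a b) (contract_weight \<omega> a b) \<tau>) =
      (y - 1) ^ card (verts G - {b}) * w2"
    using non_loop.IH(2) finite_multigraph_contract_edge[OF non_loop.prems ab(1)] \<open>a \<noteq> b\<close>
    by simp
  have "(\<Sum>\<sigma>\<in>verts G \<rightarrow>\<^sub>E S. boltzmann_weight g y G \<omega> \<sigma>) =
      (\<Sum>\<sigma>\<in>verts G \<rightarrow>\<^sub>E S. boltzmann_weight g y (delete_edge G e) \<omega> \<sigma> +
        (y - 1) * (kronecker (\<sigma> a) (\<sigma> b) * boltzmann_weight g y (delete_edge G e) \<omega> \<sigma>))"
    using fin non_loop.hyps
    by (intro sum.cong refl) (simp add: boltzmann_weight_delete_edge algebra_simps)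
  also have "\<dots> = (y - 1) ^ card (verts G) * w1 + (y - 1) * ((y - 1) ^ card (verts G - {b}) * w2)"
    using sum_kronecker_boltzmann_weight[of G S a b g y e \<omega>] fin ab g \<open>finite S\<close> \<open>a \<noteq> b\<close>
    by (simp add: sum.distrib sum_distrib_left[symmetric] del con)
  finally show ?case
    by (simp add: card algebra_simps)
next
  case (loop e G a \<omega> w)
  have del: "(\<Sum>\<sigma>\<in>verts G \<rightarrow>\<^sub>E S. boltzmann_weight g y (delete_edge G e) \<omega> \<sigma>) =
      (y - 1) ^ card (verts G) * w"
    using loop.IH loop.prems by (simp add: finite_multigraph_delete_edge)
  \<comment> \<open>At a loop the delta is always 1, so the edge factor is 1 + (y - 1) = y.\<close>
  have "(\<Sum>\<sigma>\<in>verts G \<rightarrow>\<^sub>E S. boltzmann_weight g y G \<omega> \<sigma>) =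
      (\<Sum>\<sigma>\<in>verts G \<rightarrow>\<^sub>E S. y * boltzmann_weight g y (delete_edge G e) \<omega> \<sigma>)"
    using loop
    by (intro sum.cong refl)
      (simp add: boltzmann_weight_delete_edge kronecker_def finite_multigraph_def)
  then show ?case
    by (simp add: sum_distrib_left[symmetric] del)
qed

lemma exp_hamiltonian:
  assumes "finite_multigraph G" "\<sigma> \<in> states G q"
  shows "exp (- \<beta> * hamiltonian G q J (\<lambda>v \<alpha>. of_nat (k v) * B \<alpha>) \<sigma>) =
    boltzmann_weight (\<lambda>n \<alpha>. exp (\<beta> * of_nat n * B \<alpha>)) (exp (\<beta> * J)) G k \<sigma>"
proof -
  have fin: "finite (verts G)" "finite (edges G)"
    using assms by (auto simp: finite_multigraph_def)
  \<comment> \<open>Only the term \<alpha> = \<sigma> v survives, and it does occur in the sum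
    because a state takes its values in \<open>{1..q}\<close>.\<close>
  have field: "(\<Sum>\<alpha>=1..q. of_nat (k v) * B \<alpha> * kronecker \<alpha> (\<sigma> v)) = of_nat (k v) * B (\<sigma> v)"
    if "v \<in> verts G" for v
  proof -
    have "\<sigma> v \<in> {1..q}"
      using assms that by (auto simp: states_def)
    then show ?thesis
      by (simp add: kronecker_def if_distrib cong: if_cong)
  qed
  \<comment> \<open>The exponential is affine in the delta because the delta takes only the values 0
    and 1.\<close>
  have edge: "exp (\<beta> * J * kronecker_ends \<sigma> p) = 1 + (exp (\<beta> * J) - 1) * kronecker_ends \<sigma> p"
    for p
    using kronecker_ends_cases[of \<sigma> p] by auto
  have "hamiltonian G q J (\<lambda>v \<alpha>. of_nat (k v) * B \<alpha>) \<sigma> =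
      - J * (\<Sum>e\<in>edges G. kronecker_ends \<sigma> (ends G e)) -
      (\<Sum>v\<in>verts G. of_nat (k v) * B (\<sigma> v))"
    by (simp only: hamiltonian_def field cong: sum.cong)
  then have "- \<beta> * hamiltonian G q J (\<lambda>v \<alpha>. of_nat (k v) * B \<alpha>) \<sigma> =
      (\<Sum>e\<in>edges G. \<beta> * J * kronecker_ends \<sigma> (ends G e)) +
      (\<Sum>v\<in>verts G. \<beta> * of_nat (k v) * B (\<sigma> v))"
    by (simp add: right_diff_distrib sum_distrib_left sum_negf mult.assoc)
  then show ?thesis
    using fin by (simp add: boltzmann_weight_def exp_add exp_sum edge)
qed

theorem theorem5p1:
  fixes G :: "('v, 'e) multigraph" and q :: nat and \<beta> J :: complex
    and B :: "nat \<Rightarrow> complex" and k :: "'v \<Rightarrow> nat"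
  assumes "q \<ge> 1"
    and "exp (\<beta> * J) \<noteq> 1"
    and "finite_multigraph G"
    and "\<And>v. v \<in> verts G \<Longrightarrow> k v > 0"
  shows "partition_function G q \<beta> J (\<lambda>v \<alpha>. of_nat (k v) * B \<alpha>) =
    (exp (\<beta> * J) - 1) ^ card (verts G) *
    W_polynomial G k
      (\<lambda>n. 1 / (exp (\<beta> * J) - 1) * (\<Sum>\<alpha>=1..q. exp (\<beta> * of_nat n * B \<alpha>)))
      (exp (\<beta> * J))"
proof -
  define y where "y = exp (\<beta> * J)"
  define g where "g = (\<lambda>n \<alpha>. exp (\<beta> * of_nat n * B \<alpha>))"
  define x where "x = (\<lambda>n. 1 / (y - 1) * (\<Sum>\<alpha>=1..q. g n \<alpha>))"
  let ?Z = "partition_function G q \<beta> J (\<lambda>v \<alpha>. of_nat (k v) * B \<alpha>)"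
  have y: "y \<noteq> 1"
    using assms(2) by (simp add: y_def)
  have "?Z = (\<Sum>\<sigma>\<in>verts G \<rightarrow>\<^sub>E {1..q}. boltzmann_weight g y G k \<sigma>)"
    unfolding partition_function_def g_def y_def states_def[symmetric]
    using assms(3) by (intro sum.cong refl exp_hamiltonian)
  \<comment> \<open>Here \<open>y \<noteq> 1\<close> makes the division in \<open>x\<close>
    meaningful.\<close>
  moreover have "(y - 1) * x n = (\<Sum>\<alpha>=1..q. g n \<alpha>)" for n
    using y by (simp add: x_def)
  moreover have "g (m + n) \<alpha> = g m \<alpha> * g n \<alpha>" for m n \<alpha>
    by (simp add: g_def exp_add[symmetric] algebra_simps)
  ultimately have val: "?Z = (y - 1) ^ card (verts G) * w" if "W_rel x y G k w" for w
    using W_rel_sum_boltzmann_weight[OF that assms(3), of "{1..q}" g] by simp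
  obtain w where w: "W_rel x y G k w"
    using W_rel_exists assms(3) by (metis finite_multigraph_def)
  have "W_polynomial G k x y = w"
    unfolding W_polynomial_def
  proof (rule the_equality)
    show "W_rel x y G k w" by (rule w)
  next
    fix w' assume "W_rel x y G k w'"
    \<comment> \<open>Both outcomes give the same product with a power of \<open>y - 1\<close>,
      which is nonzero and cancels.\<close>
    from val[OF this] val[OF w] show "w' = w"
      using y by simp
  qed
  then show ?thesis
    using val[OF w] by (simp add: x_def y_def g_def)
qed

end
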